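(* Let $S=\begin{pmatrix}a&b\\c&d\end{pmatrix}$ and $T=\begin{pmatrix}\lambda&0\\0&\mu\end{pmatrix}$ in $\mathrm{SL}(2,\mathbb H)$ generate a discrete non-elementary subgroup of $\mathrm{SL}(2,\mathbb H)$. Let $\alpha=\arg(\lambda)$, $\beta=\arg(\mu)$, with $0<\alpha+\beta<2\pi$. Suppose $$\big||ad|-1\big|>\cot^2\Big(\frac{\alpha+\beta}{2}\Big)-3 .$$ Then $\langle S,T\rangle$ is not an extreme group, i.e. $$\{(\Re\lambda-\Re\mu)^2+(|\Im\lambda|+|\Im\mu|)^2\}\,(1+|bc|)\ne1 .$$
   Context: $\mathbb H$ is the division ring of real quaternions. For $q=q_0+q_1i+q_2j+q_3k\in\mathbb H$ ($q_0,\dots,q_3\in\mathbb R$): $\Re q=q_0$, $\Im q=q_1i+q_2j+q_3k$ (a quaternion), $\overline q=\Re q-\Im q$, $|q|=\sqrt{q_0^2+q_1^2+q_2^2+q_3^2}$. Every nonzero quaternion $q$ is conjugate in $\mathbb H$ to a complex number $re^{i\theta}$ with $r=|q|$ and a unique $\theta\in[0,\pi]$; this $\theta$ is denoted $\arg(q)$. For a $2\times2$ quaternionic matrix $A=\begin{pmatrix}a&b\\c&d\end{pmatrix}$, $\det A=\sqrt{|a|^2|d|^2+|b|^2|c|^2-2\Re(a\overline c d\overline b)}$ (which equals $|ad-aca^{-1}b|$ when $a\ne0$); $\mathrm{SL}(2,\mathbb H)$ is the group of such matrices with $\det=1$. It acts on $\widehat{\mathbb H}=\mathbb H\cup\{\infty\}$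 by $Z\mapsto(aZ+b)(cZ+d)^{-1}$, and by Poincaré extension on hyperbolic 5-space $\mathbf H^5$ (with boundary $\widehat{\mathbb H}$) by orientation-preserving isometries. A subgroup is elementary if it has a finite orbit in $\mathbf H^5\cup\widehat{\mathbb H}$, and non-elementary otherwise. A discrete non-elementary group $\langle S,T\rangle$ with $S=\begin{pmatrix}a&b\\c&d\end{pmatrix}$ and $T=\begin{pmatrix}\lambda&0\\0&\mu\end{pmatrix}$ in $\mathrm{SL}(2,\mathbb H)$ is called extreme if equality holds in the Jørgensen-type inequality $\{(\Re\lambda-\Re\mu)^2+(|\Im\lambda|+|\Im\mu|)^2\}(1+|bc|)\ge1$. *)

theory Defs
  imports "HOL-Analysis.Analysis" "HOL-Algebra.Generated_Groups"
begin

section \<open>Quaternions as a real normed division algebra\<close>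

datatype quat = Quat (q0: real) (q1: real) (q2: real) (q3: real)

lemma quat_eq_iff: "p = q \<longleftrightarrow> q0 p = q0 q \<and> q1 p = q1 q \<and> q2 p = q2 q \<and> q3 p = q3 q"
  by (cases p; cases q) simp

instantiation quat :: ring_1
begin

definition zero_quat :: quat where "0 = Quat 0 0 0 0"

definition one_quat :: quat where "1 = Quat 1 0 0 0"

definition plus_quat :: "quat \<Rightarrow> quat \<Rightarrow> quat" where
  "p + q = Quat (q0 p + q0 q) (q1 p + q1 q) (q2 p + q2 q) (q3 p + q3 q)"

definition uminus_quat :: "quat \<Rightarrow> quat" where
  "- q = Quat (- q0 q) (- q1 q) (- q2 q) (- q3 q)"

definition minus_quat :: "quat \<Rightarrow> quat \<Rightarrow> quat" where
  "p - q = Quat (q0 p - q0 q) (q1 p - q1 q) (q2 p - q2 q) (q3 p - q3 q)"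

definition times_quat :: "quat \<Rightarrow> quat \<Rightarrow> quat" where
  "p * q = Quat
     (q0 p * q0 q - q1 p * q1 q - q2 p * q2 q - q3 p * q3 q)
     (q0 p * q1 q + q1 p * q0 q + q2 p * q3 q - q3 p * q2 q)
     (q0 p * q2 q - q1 p * q3 q + q2 p * q0 q + q3 p * q1 q)
     (q0 p * q3 q + q1 p * q2 q - q2 p * q1 q + q3 p * q0 q)"

instance
  by standard
    (simp_all add: quat_eq_iff zero_quat_def one_quat_def plus_quat_def uminus_quat_def
      minus_quat_def times_quat_def algebra_simps)

end

lemma quat_zero_sel [simp]: "q0 0 = 0" "q1 0 = 0" "q2 0 = 0" "q3 0 = 0"
  by (simp_all add: zero_quat_def)

lemma quat_one_sel [simp]: "q0 1 = 1" "q1 1 = 0" "q2 1 = 0" "q3 1 = 0"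
  by (simp_all add: one_quat_def)

lemma quat_add_sel [simp]:
  "q0 (p + q) = q0 p + q0 q" "q1 (p + q) = q1 p + q1 q"
  "q2 (p + q) = q2 p + q2 q" "q3 (p + q) = q3 p + q3 q"
  by (simp_all add: plus_quat_def)

lemma quat_uminus_sel [simp]:
  "q0 (- q) = - q0 q" "q1 (- q) = - q1 q" "q2 (- q) = - q2 q" "q3 (- q) = - q3 q"
  by (simp_all add: uminus_quat_def)

lemma quat_diff_sel [simp]:
  "q0 (p - q) = q0 p - q0 q" "q1 (p - q) = q1 p - q1 q"
  "q2 (p - q) = q2 p - q2 q" "q3 (p - q) = q3 p - q3 q"
  by (simp_all add: minus_quat_def)

lemma quat_mult_sel [simp]:
  "q0 (p * q) = q0 p * q0 q - q1 p * q1 q - q2 p * q2 q - q3 p * q3 q"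
  "q1 (p * q) = q0 p * q1 q + q1 p * q0 q + q2 p * q3 q - q3 p * q2 q"
  "q2 (p * q) = q0 p * q2 q - q1 p * q3 q + q2 p * q0 q + q3 p * q1 q"
  "q3 (p * q) = q0 p * q3 q + q1 p * q2 q - q2 p * q1 q + q3 p * q0 q"
  by (simp_all add: times_quat_def)

instantiation quat :: real_algebra_1
begin

definition scaleR_quat :: "real \<Rightarrow> quat \<Rightarrow> quat" where
  "r *\<^sub>R q = Quat (r * q0 q) (r * q1 q) (r * q2 q) (r * q3 q)"

instance
  by standard (simp_all add: quat_eq_iff scaleR_quat_def algebra_simps)

end

lemma quat_scaleR_sel [simp]:
  "q0 (r *\<^sub>R q) = r * q0 q" "q1 (r *\<^sub>R q) = r * q1 q"
  "q2 (r *\<^sub>R q) = r * q2 q" "q3 (r *\<^sub>R q) = r * q3 q"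
  by (simp_all add: scaleR_quat_def)

definition qcnj :: "quat \<Rightarrow> quat" where
  "qcnj q = Quat (q0 q) (- q1 q) (- q2 q) (- q3 q)"

lemma qcnj_sel [simp]:
  "q0 (qcnj q) = q0 q" "q1 (qcnj q) = - q1 q" "q2 (qcnj q) = - q2 q" "q3 (qcnj q) = - q3 q"
  by (simp_all add: qcnj_def)

lemma quat_sum_squares_pos:
  assumes "q \<noteq> 0"
  shows "(q0 q)\<^sup>2 + (q1 q)\<^sup>2 + (q2 q)\<^sup>2 + (q3 q)\<^sup>2 > 0"
proof -
  have "q0 q \<noteq> 0 \<or> q1 q \<noteq> 0 \<or> q2 q \<noteq> 0 \<or> q3 q \<noteq> 0"
    using assms by (simp add: quat_eq_iff)
  then show ?thesis
    by (auto simp: add_pos_nonneg add_nonneg_pos)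
qed

instantiation quat :: real_div_algebra
begin

definition inverse_quat :: "quat \<Rightarrow> quat" where
  "inverse q = inverse ((q0 q)\<^sup>2 + (q1 q)\<^sup>2 + (q2 q)\<^sup>2 + (q3 q)\<^sup>2) *\<^sub>R qcnj q"

definition divide_quat :: "quat \<Rightarrow> quat \<Rightarrow> quat" where
  "divide_quat p q = p * inverse q"

instance
proof
  fix p q :: quat
  show "inverse (0::quat) = 0"
    by (simp add: inverse_quat_def)
  show "p div q = p * inverse q"
    by (rule divide_quat_def)
  assume "q \<noteq> 0"
  then have "(q0 q)\<^sup>2 + (q1 q)\<^sup>2 + (q2 q)\<^sup>2 + (q3 q)\<^sup>2 \<noteq> 0"
    using quat_sum_squares_pos by force
  moreover have "q * qcnj q = ((q0 q)\<^sup>2 + (q1 q)\<^sup>2 + (q2 q)\<^sup>2 + (q3 q)\<^sup>2) *\<^sub>R 1"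
    and "qcnj q * q = ((q0 q)\<^sup>2 + (q1 q)\<^sup>2 + (q2 q)\<^sup>2 + (q3 q)\<^sup>2) *\<^sub>R 1"
    by (simp_all add: quat_eq_iff power2_eq_square)
  ultimately show "inverse q * q = 1" "q * inverse q = 1"
    by (simp_all add: inverse_quat_def)
qed

end

instantiation quat :: real_inner
begin

definition inner_quat :: "quat \<Rightarrow> quat \<Rightarrow> real" where
  "inner_quat p q = q0 p * q0 q + q1 p * q1 q + q2 p * q2 q + q3 p * q3 q"

definition norm_quat :: "quat \<Rightarrow> real" where
  "norm_quat q = sqrt ((q0 q)\<^sup>2 + (q1 q)\<^sup>2 + (q2 q)\<^sup>2 + (q3 q)\<^sup>2)"

definition sgn_quat :: "quat \<Rightarrow> quat" where
  "sgn_quat q = q /\<^sub>R norm q"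

definition dist_quat :: "quat \<Rightarrow> quat \<Rightarrow> real" where
  "dist_quat p q = norm (p - q)"

definition uniformity_quat :: "(quat \<times> quat) filter" where
  "uniformity_quat = (INF e\<in>{0 <..}. principal {(x, y). dist x y < e})"

definition open_quat :: "quat set \<Rightarrow> bool" where
  "open_quat U \<longleftrightarrow> (\<forall>x\<in>U. \<forall>\<^sub>F (x', y) in uniformity. x' = x \<longrightarrow> y \<in> U)"

instance
proof
  fix p q s :: quat and r :: real and U :: "quat set"
  show "dist p q = norm (p - q)" by (rule dist_quat_def)
  show "sgn q = q /\<^sub>R norm q" by (rule sgn_quat_def)
  show "uniformity = (INF e\<in>{0 <..}. principal {(x :: quat, y). dist x y < e})"
    by (rule uniformity_quat_def)
  show "open U \<longleftrightarrow> (\<forall>x\<in>U. \<forall>\<^sub>F (x', y) in uniformity. x' = x \<longrightarrow> y \<in> U)"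
    by (rule open_quat_def)
  show "inner p q = inner q p" by (simp add: inner_quat_def mult.commute)
  show "inner (p + q) s = inner p s + inner q s" by (simp add: inner_quat_def algebra_simps)
  show "inner (r *\<^sub>R p) q = r * inner p q" by (simp add: inner_quat_def algebra_simps)
  show "0 \<le> inner q q" by (simp add: inner_quat_def)
  show "inner q q = 0 \<longleftrightarrow> q = 0"
    using quat_sum_squares_pos[of q]
    by (cases "q = 0") (simp_all add: inner_quat_def power2_eq_square)
  show "norm q = sqrt (inner q q)"
    by (simp add: norm_quat_def inner_quat_def power2_eq_square)
qed

end

instance quat :: real_normed_div_algebra
proof
  fix p q :: quat
  have "(norm (p * q))\<^sup>2 = (norm p * norm q)\<^sup>2"
    by (simp add: norm_quat_def power_mult_distrib) (simp add: power2_eq_square algebra_simps)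
  then show "norm (p * q) = norm p * norm q"
    by (simp add: power2_eq_iff_nonneg)
qed

text \<open>The imaginary part is the quaternion \<open>q\<^sub>1 i + q\<^sub>2 j + q\<^sub>3 k\<close>; the real part is \<^const>\<open>q0\<close>.\<close>

definition qIm :: "quat \<Rightarrow> quat" where
  "qIm q = Quat 0 (q1 q) (q2 q) (q3 q)"

definition quat_of_complex :: "complex \<Rightarrow> quat" where
  "quat_of_complex z = Quat (Re z) (Im z) 0 0"

definition qarg :: "quat \<Rightarrow> real" where
  "qarg q = (THE \<theta>. 0 \<le> \<theta> \<and> \<theta> \<le> pi \<and>
     (\<exists>u. u \<noteq> 0 \<and> u * q * inverse u = quat_of_complex (rcis (norm q) \<theta>)))"


section \<open>The group SL(2,H)\<close>

definition mat22 :: "quat \<Rightarrow> quat \<Rightarrow> quat \<Rightarrow> quat \<Rightarrow> quat^2^2" where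
  "mat22 a b c d = vector [vector [a, b], vector [c, d]]"

lemma mat22_nth [simp]:
  "mat22 a b c d $ 1 $ 1 = a" "mat22 a b c d $ 1 $ 2 = b"
  "mat22 a b c d $ 2 $ 1 = c" "mat22 a b c d $ 2 $ 2 = d"
  by (simp_all add: mat22_def)

text \<open>
  Over a noncommutative ring the library determinant is not the right notion; this is
  the Dieudonne determinant, which is real and nonnegative.
\<close>

definition qdet :: "quat^2^2 \<Rightarrow> real" where
  "qdet A = (let a = A$1$1; b = A$1$2; c = A$2$1; d = A$2$2 in
     sqrt ((norm a)\<^sup>2 * (norm d)\<^sup>2 + (norm b)\<^sup>2 * (norm c)\<^sup>2
           - 2 * q0 (a * qcnj c * d * qcnj b)))"

definition SL2H :: "(quat^2^2) monoid" where
  "SL2H = \<lparr>carrier = {A. qdet A = 1}, mult = (**), one = mat 1\<rparr>"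


section \<open>Action on hyperbolic 5-space and its boundary\<close>

text \<open>The boundary is \<open>quat option\<close>, with \<^const>\<open>None\<close> the point at infinity.\<close>

definition moebius :: "quat^2^2 \<Rightarrow> quat option \<Rightarrow> quat option" where
  "moebius A x = (let a = A$1$1; b = A$1$2; c = A$2$1; d = A$2$2 in
     case x of
       None \<Rightarrow> if c = 0 then None else Some (a * inverse c)
     | Some z \<Rightarrow> if c * z + d = 0 then None else Some ((a * z + b) * inverse (c * z + d)))"

definition hyperbolic5 :: "(quat \<times> real) set" where
  "hyperbolic5 = {(z, t). t > 0}"

text \<open>
  The Poincare extension of \<^const>\<open>moebius\<close> to the upper half-space, for matrices of
  determinant 1. Setting \<open>t = 0\<close> in the formula recovers the action on
  the boundary points \<open>Some z\<close> that are not sent to \<^const>\<open>None\<close>.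
\<close>

definition poincare_ext :: "quat^2^2 \<Rightarrow> quat \<times> real \<Rightarrow> quat \<times> real" where
  "poincare_ext A = (\<lambda>(z, t). let a = A$1$1; b = A$1$2; c = A$2$1; d = A$2$2;
       N = (norm (c * z + d))\<^sup>2 + (norm c)\<^sup>2 * t\<^sup>2 in
     (((a * z + b) * qcnj (c * z + d) + t\<^sup>2 *\<^sub>R (a * qcnj c)) /\<^sub>R N, t / N))"

definition elementary :: "(quat^2^2) set \<Rightarrow> bool" where
  "elementary G \<longleftrightarrow>
     (\<exists>p\<in>hyperbolic5. finite ((\<lambda>A. poincare_ext A p) ` G)) \<or>
     (\<exists>x. finite ((\<lambda>A. moebius A x) ` G))"

text \<open>
  The left-hand side of the Jorgensen-type inequality \<open>\<dots> \<ge> 1\<close>, meaningful for diagonal \<open>T\<close> only.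
\<close>

definition jorgensen_value :: "quat^2^2 \<Rightarrow> quat^2^2 \<Rightarrow> real" where
  "jorgensen_value S T = (let b = S$1$2; c = S$2$1; l = T$1$1; m = T$2$2 in
     ((q0 l - q0 m)\<^sup>2 + (norm (qIm l) + norm (qIm m))\<^sup>2) * (1 + norm (b * c)))"

text \<open>Extremality is a property of the generating pair, not only of the generated group.\<close>

definition extreme :: "quat^2^2 \<Rightarrow> quat^2^2 \<Rightarrow> bool" where
  "extreme S T \<longleftrightarrow>
     S \<in> carrier SL2H \<and> T \<in> carrier SL2H \<and> T$1$2 = 0 \<and> T$2$1 = 0 \<and>
     discrete (generate SL2H {S, T}) \<and> \<not> elementary (generate SL2H {S, T}) \<and>
     jorgensen_value S T = 1"

end

(* Put t = (alpha + beta)/2. The polar forms of lambda and mu with |lambda||mu| = 1 turn the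
   first factor into |lambda|^2 + |mu|^2 - 2 cos(2t) >= 4 sin^2 t, so equality in the
   Jorgensen-type inequality would force 4(1 + |bc|) <= 1 + cot^2 t. But the determinant lies
   between ||ad| - |bc|| and |ad| + |bc|, so ||ad| - 1| <= |bc|, against the hypothesis. *)
theory Submission
  imports Defs
begin

lemma norm_qcnj [simp]: "norm (qcnj q) = norm q"
  by (simp add: norm_quat_def)

lemma norm_quat_Re_Im: "(norm q)\<^sup>2 = (q0 q)\<^sup>2 + (norm (qIm q))\<^sup>2"
  by (simp add: norm_quat_def qIm_def)

lemma abs_q0_le_norm: "\<bar>q0 q\<bar> \<le> norm q"
  by (rule power2_le_imp_le) (simp_all add: norm_quat_Re_Im[of q])

lemma q0_mult_commute: "q0 (p * q) = q0 (q * p)"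
  by simp

text \<open>The real part ignores the order of two factors, like a trace, so \<open>u\<close> and
  its inverse cancel. This pins down the cosine of the angle in \<open>qarg\<close>.\<close>

lemma q0_conjugate:
  assumes "u \<noteq> 0"
  shows "q0 (u * q * inverse u) = q0 q"
  using assms q0_mult_commute[of "u * q" "inverse u"]
  by (simp del: quat_mult_sel flip: mult.assoc)

text \<open>Gives the existence half of \<open>qarg\<close>: it is enough to solve the linear
  equation \<open>u * q = w * u\<close> with \<open>u\<close> nonzero, where \<open>w\<close> lies
  in the closed upper half-plane.\<close>

lemma conjugate_to_complex:
  "\<exists>u. u \<noteq> 0 \<and> u * q * inverse u = Quat (q0 q) (norm (qIm q)) 0 0"
proof -
  define n where "n = norm (qIm q)"
  define w where "w = Quat (q0 q) n 0 0"
  have n2: "n * n = q1 q * q1 q + q2 q * q2 q + q3 q * q3 q"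
    by (simp add: n_def norm_quat_def qIm_def power2_eq_square)
  have "\<exists>u. u \<noteq> 0 \<and> u * q = w * u"
  proof (cases "n + q1 q = 0 \<and> q2 q = 0 \<and> q3 q = 0")
    case True
    \<comment> \<open>The imaginary part of \<open>q\<close> is -n i, where the witness n i + p of
      the other case vanishes. Conjugation by j reverses the sign of i.\<close>
    then have "Quat 0 0 1 0 * q = w * Quat 0 0 1 0" and "Quat 0 0 1 0 \<noteq> 0"
      by (auto simp: quat_eq_iff w_def)
    then show ?thesis by blast
  next
    case False
    \<comment> \<open>For pure \<open>p\<close> with \<open>p\<^sup>2 = -n\<^sup>2\<close>, the quaternion \<open>u = n i + p\<close> satisfies \<open>u p = n i u\<close>.\<close>
    define u where "u = Quat 0 (n + q1 q) (q2 q) (q3 q)"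
    have "u * q = w * u"
      using n2 by (simp add: quat_eq_iff w_def u_def algebra_simps)
    moreover have "u \<noteq> 0"
      using False by (auto simp: quat_eq_iff u_def)
    ultimately show ?thesis by blast
  qed
  then obtain u where "u \<noteq> 0" "u * q = w * u"
    by blast
  then have "u * q * inverse u = w"
    by (simp add: mult.assoc)
  with \<open>u \<noteq> 0\<close> show ?thesis
    unfolding w_def n_def by blast
qed

text \<open>The polar form also holds for \<open>q = 0\<close>, where \<^const>\<open>qarg\<close> is unspecified.\<close>

lemma qarg_polar:
  "q0 q = norm q * cos (qarg q)" "norm (qIm q) = norm q * sin (qarg q)"
proof -
  have "q0 q = norm q * cos (qarg q) \<and> norm (qIm q) = norm q * sin (qarg q)"
  proof (cases "q = 0")
    case True
    then show ?thesis by (simp add: qIm_def norm_quat_def)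
  next
    case False
    let ?P = "\<lambda>\<theta>. 0 \<le> \<theta> \<and> \<theta> \<le> pi \<and>
      (\<exists>u. u \<noteq> 0 \<and> u * q * inverse u = quat_of_complex (rcis (norm q) \<theta>))"
    \<comment> \<open>Conjugation preserves the real part and cosine is injective on [0, pi], so no
      other angle is possible.\<close>
    define \<theta> where "\<theta> = arccos (q0 q / norm q)"
    have bounds: "-1 \<le> q0 q / norm q" "q0 q / norm q \<le> 1"
      using abs_q0_le_norm[of q] False by (simp_all add: field_simps)
    have range: "0 \<le> \<theta>" "\<theta> \<le> pi"
      using arccos_bounded[OF bounds] by (simp_all add: \<theta>_def)
    have cos: "q0 q = norm q * cos \<theta>"
      using cos_arccos[OF bounds] False by (simp add: \<theta>_def)
    have "(norm q * sin \<theta>)\<^sup>2 = (norm q)\<^sup>2 - (q0 q)\<^sup>2"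
      by (simp add: cos power_mult_distrib sin_squared_eq algebra_simps)
    also have "\<dots> = (norm (qIm q))\<^sup>2"
      by (simp add: norm_quat_Re_Im[of q])
    \<comment> \<open>Sine is nonnegative on [0, pi], so the squares can be removed.\<close>
    finally have sin: "norm (qIm q) = norm q * sin \<theta>"
      using range by (simp add: power2_eq_iff_nonneg sin_ge_zero)
    have "?P \<theta>"
      using range conjugate_to_complex[of q]
      by (simp add: quat_of_complex_def flip: cos sin)
    moreover have "\<phi> = \<theta>" if "?P \<phi>" for \<phi>
    proof -
      from that obtain u where "u \<noteq> 0"
        "u * q * inverse u = quat_of_complex (rcis (norm q) \<phi>)"
        by blast
      then have "q0 q = norm q * cos \<phi>"
        using q0_conjugate[of u q] by (simp add: quat_of_complex_def del: quat_mult_sel)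
      then have "cos \<phi> = cos \<theta>"
        using cos False by simp
      then show ?thesis
        using cos_inj_pi[of \<phi> \<theta>] that range by blast
    qed
    ultimately have "qarg q = \<theta>"
      unfolding qarg_def by (rule the_equality)
    then show ?thesis
      using cos sin by simp
  qed
  then show "q0 q = norm q * cos (qarg q)" "norm (qIm q) = norm q * sin (qarg q)"
    by simp_all
qed

text \<open>The law of cosines: the left side is the squared distance in the complex plane between
  representatives of \<open>p\<close> and \<open>q\<close> placed on opposite sides of the real
  axis, so their angles add.\<close>

lemma Re_Im_distance_polar:
  "(q0 p - q0 q)\<^sup>2 + (norm (qIm p) + norm (qIm q))\<^sup>2 =
     (norm p)\<^sup>2 + (norm q)\<^sup>2 - 2 * norm (p * q) * cos (qarg p + qarg q)"
proof -
  have "(q0 p - q0 q)\<^sup>2 + (norm (qIm p) + norm (qIm q))\<^sup>2 =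
      (norm p)\<^sup>2 + (norm q)\<^sup>2 - 2 * (q0 p * q0 q - norm (qIm p) * norm (qIm q))"
    unfolding norm_quat_Re_Im[of p] norm_quat_Re_Im[of q]
    by (simp add: power2_eq_square algebra_simps)
  also have "q0 p * q0 q - norm (qIm p) * norm (qIm q) =
      norm (p * q) * cos (qarg p + qarg q)"
    unfolding qarg_polar[of p] qarg_polar[of q]
    by (simp add: cos_add norm_mult algebra_simps)
  finally show ?thesis by simp
qed

text \<open>Combines |p|^2 + |q|^2 \<ge> 2|p||q| with the half-angle formula 1 - cos 2t = 2 sin^2
  t.\<close>

lemma Re_Im_distance_ge:
  "4 * norm (p * q) * (sin ((qarg p + qarg q) / 2))\<^sup>2 \<le>
     (q0 p - q0 q)\<^sup>2 + (norm (qIm p) + norm (qIm q))\<^sup>2"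
proof -
  let ?t = "(qarg p + qarg q) / 2"
  have cos: "cos (qarg p + qarg q) = 1 - 2 * (sin ?t)\<^sup>2"
    using cos_double_sin[of ?t] by (simp del: distrib_left_numeral)
  have "0 \<le> (norm p - norm q)\<^sup>2"
    by simp
  then show ?thesis
    unfolding Re_Im_distance_polar cos
    by (simp add: norm_mult power2_diff right_diff_distrib)
qed

text \<open>A real part is at most the norm, so the cross term under the root in \<open>qdet\<close>
  is at most 2|ad||bc| in absolute value. This traps the radicand between the squares of |ad| - |bc|
  and |ad| + |bc|.\<close>

lemma norm_ad_minus_qdet_le: "\<bar>norm (a * d) - qdet (mat22 a b c d)\<bar> \<le> norm (b * c)"
proof -
  define A B e where "A = norm (a * d)" and "B = norm (b * c)"
    and "e = q0 (a * qcnj c * d * qcnj b)"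
  have nonneg: "0 \<le> A" "0 \<le> B"
    by (simp_all add: A_def B_def)
  have "\<bar>e\<bar> \<le> A * B"
    using abs_q0_le_norm[of "a * qcnj c * d * qcnj b"]
    by (simp add: A_def B_def e_def norm_mult mult_ac del: quat_mult_sel)
  then have bounds: "(A - B)\<^sup>2 \<le> A\<^sup>2 + B\<^sup>2 - 2 * e" "A\<^sup>2 + B\<^sup>2 - 2 * e \<le> (A + B)\<^sup>2"
    by (simp_all add: power2_diff power2_sum abs_le_iff)
  have qdet: "qdet (mat22 a b c d) = sqrt (A\<^sup>2 + B\<^sup>2 - 2 * e)"
    by (simp add: qdet_def Let_def A_def B_def e_def norm_mult power_mult_distrib
        del: quat_mult_sel)
  have "\<bar>A - B\<bar> \<le> qdet (mat22 a b c d)"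
    unfolding qdet using real_sqrt_le_mono[OF bounds(1)] by simp
  moreover have "qdet (mat22 a b c d) \<le> A + B"
    unfolding qdet using real_sqrt_le_mono[OF bounds(2)] nonneg by simp
  ultimately show ?thesis
    unfolding A_def B_def by linarith
qed

lemma qdet_diagonal: "qdet (mat22 p 0 0 q) = norm (p * q)"
  by (simp add: qdet_def norm_mult real_sqrt_mult)

theorem corollary4p5:
  fixes a b c d lam mu :: quat and S T :: "quat^2^2" and \<alpha> \<beta> :: real
  assumes "S = mat22 a b c d" and "T = mat22 lam 0 0 mu"
    and "S \<in> carrier SL2H" and "T \<in> carrier SL2H"
    and "discrete (generate SL2H {S, T})"
    and "\<not> elementary (generate SL2H {S, T})"
    and "\<alpha> = qarg lam" and "\<beta> = qarg mu"
    and "0 < \<alpha> + \<beta>" and "\<alpha> + \<beta> < 2 * pi"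
    and "\<bar>norm (a * d) - 1\<bar> > (cot ((\<alpha> + \<beta>) / 2))\<^sup>2 - 3"
  shows "\<not> extreme S T \<and>
    ((q0 lam - q0 mu)\<^sup>2 + (norm (qIm lam) + norm (qIm mu))\<^sup>2) * (1 + norm (b * c)) \<noteq> 1"
proof -
  define K where "K = (q0 lam - q0 mu)\<^sup>2 + (norm (qIm lam) + norm (qIm mu))\<^sup>2"
  define t where "t = (\<alpha> + \<beta>) / 2"
  have "norm (lam * mu) = 1"
    using assms by (simp add: SL2H_def qdet_diagonal)
  then have K: "4 * (sin t)\<^sup>2 \<le> K"
    using Re_Im_distance_ge[of lam mu] assms by (simp add: K_def t_def)
  have ad: "\<bar>norm (a * d) - 1\<bar> \<le> norm (b * c)"
    using norm_ad_minus_qdet_le[of a d b c] assms by (simp add: SL2H_def)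
  have "K * (1 + norm (b * c)) \<noteq> 1"
  proof
    assume "K * (1 + norm (b * c)) = 1"
    then have "4 * (sin t)\<^sup>2 * (1 + norm (b * c)) \<le> 1"
      using mult_right_mono[OF K, of "1 + norm (b * c)"] by simp
    \<comment> \<open>The bounds on \<alpha> + \<beta> put t strictly between 0 and pi, which allows
      division by sin^2 t.\<close>
    moreover have "0 < sin t"
      using assms by (simp add: t_def sin_gt_zero)
    ultimately have "4 * (1 + norm (b * c)) \<le> 1 / (sin t)\<^sup>2"
      by (simp add: field_simps)
    also have "1 / (sin t)\<^sup>2 = 1 + (cot t)\<^sup>2"
      using \<open>0 < sin t\<close> by (simp add: cot_def field_simps)
    finally have "4 * norm (b * c) \<le> (cot t)\<^sup>2 - 3"
      by simp
    moreover have "(cot t)\<^sup>2 - 3 < \<bar>norm (a * d) - 1\<bar>"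
      using assms by (simp add: t_def)
    \<comment> \<open>Chaining the three bounds gives 4|bc| < |bc|, impossible for a norm.\<close>
    ultimately show False
      using ad norm_ge_zero[of "b * c"] by linarith
  qed
  then show ?thesis
    using assms by (simp add: extreme_def jorgensen_value_def Let_def K_def)
qed

end
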